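(* Let $\mathbb{A}$ be a commutative ring with identity, and let $a,b\in\mathbb{A}$ be such that the equation $ax+by=1$ has a solution $(x,y)\in\mathbb{A}^2$. Let $f_n(x,y)\in\mathbb{A}[x,y]$ ($n\ge -1$) be the polynomials satisfying $f_n(x,y)=x f_{n-1}(x,y)-y^2 f_{n-2}(x,y)$ for $n\ge 1$, with initial values $f_{-1}(x,y)=0$ and $f_0(x,y)=1$. Then: (i) $T_n(a,b)\sim_u \mathrm{diag}(1,\ldots,1,f_n(a,b))$ for all $n\ge 2$; (ii) $P_n(a,b)\sim_u \mathrm{diag}(1,\ldots,1,(a+2b)f_{n-1}(a,b))$ for all $n\ge 2$; (iii) $K_n(a,b)\sim_u \mathrm{diag}(1,a,\ldots,a,a(a+nb))$ for all $n\ge 2$ (with $n-2$ diagonal entries equal to $a$ between the first and the last entry); (iv) $C_n(a,b)\sim_u I_{n-2}\oplus C$ for all $n\ge 4$, where \[ C=\begin{cases} f_q(a,b)\begin{pmatrix} a&2b\\ 2b&a\end{pmatrix} & \text{if } n-2=2q,\\[2mm] \big(f_{q+1}(a,b)-b f_q(a,b)\big)\begin{pmatrix}1&0\\0&a+2b\end{pmatrix} & \text{if } n-2=2q+1. \end{cases} \]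
   Context: For $M,N\in M_{n\times n}(\mathbb{A})$, write $N\sim_u M$ (unitary equivalent) if there exist $P,Q\in SL_n(\mathbb{A})$ with $N=PMQ$. The symbol $\oplus$ denotes block diagonal sum of matrices, $I_n$ is the $n\times n$ identity matrix. Let $A(\mathcal{K}_n)$, $A(\mathcal{P}_n)$, $A(\mathcal{C}_n)$ be the adjacency matrices of the complete graph, the path $v_1v_2\cdots v_n$, and the cycle $v_1v_2\cdots v_nv_1$ on $n$ vertices. For $n\ge 2$ and $a,b\in\mathbb{A}$ define $K_n(a,b)=(a+b)I_n+bA(\mathcal{K}_n)$, $T_n(a,b)=aI_n+bA(\mathcal{P}_n)$, $C_n(a,b)=aI_n+bA(\mathcal{C}_n)$ (used for $n\ge 4$), and let $P_n(a,b)$ be the tridiagonal $n\times n$ matrix obtained from $T_n(a,b)$ by adding $b$ to its $(1,1)$ and $(n,n)$ entries (so its diagonal is $a+b,a,\ldots,a,a+b$ and all its entries just above and below the diagonal are $b$). *)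

theory Defs
  imports
    "Jordan_Normal_Form.Determinant"
    "HOL-Computational_Algebra.Polynomial"
begin

definition SL :: "nat \<Rightarrow> 'a :: comm_ring_1 mat set" where
  "SL n = {P \<in> carrier_mat n n. det P = 1}"

definition unitary_equivalent :: "nat \<Rightarrow> 'a :: comm_ring_1 mat \<Rightarrow> 'a mat \<Rightarrow> bool" where
  "unitary_equivalent n N M \<longleftrightarrow>
     N \<in> carrier_mat n n \<and> M \<in> carrier_mat n n \<and>
     (\<exists>P \<in> SL n. \<exists>Q \<in> SL n. N = P * M * Q)"

(* The vertices v_1, ..., v_n are represented by 0, ..., n - 1, and a simple graph on them
   by its set of edges, an edge being an unordered pair {i, j}. *)

definition adjacency_matrix :: "nat \<Rightarrow> nat set set \<Rightarrow> 'a :: comm_ring_1 mat" where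
  "adjacency_matrix n E = mat n n (\<lambda>(i, j). if {i, j} \<in> E then 1 else 0)"

definition complete_edges :: "nat \<Rightarrow> nat set set" where
  "complete_edges n = {{i, j} | i j. i < n \<and> j < n \<and> i \<noteq> j}"

definition path_edges :: "nat \<Rightarrow> nat set set" where
  "path_edges n = {{i, i + 1} | i. i + 1 < n}"

definition cycle_edges :: "nat \<Rightarrow> nat set set" where
  "cycle_edges n = path_edges n \<union> {{n - 1, 0}}"

definition K_mat :: "nat \<Rightarrow> 'a :: comm_ring_1 \<Rightarrow> 'a \<Rightarrow> 'a mat" where
  "K_mat n a b = (a + b) \<cdot>\<^sub>m 1\<^sub>m n + b \<cdot>\<^sub>m adjacency_matrix n (complete_edges n)"

definition T_mat :: "nat \<Rightarrow> 'a :: comm_ring_1 \<Rightarrow> 'a \<Rightarrow> 'a mat" where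
  "T_mat n a b = a \<cdot>\<^sub>m 1\<^sub>m n + b \<cdot>\<^sub>m adjacency_matrix n (path_edges n)"

definition C_mat :: "nat \<Rightarrow> 'a :: comm_ring_1 \<Rightarrow> 'a \<Rightarrow> 'a mat" where
  "C_mat n a b = a \<cdot>\<^sub>m 1\<^sub>m n + b \<cdot>\<^sub>m adjacency_matrix n (cycle_edges n)"

definition P_mat :: "nat \<Rightarrow> 'a :: comm_ring_1 \<Rightarrow> 'a \<Rightarrow> 'a mat" where
  "P_mat n a b = T_mat n a b + mat_diag n (\<lambda>i. if i = 0 \<or> i = n - 1 then b else 0)"

(* The ring A[x,y] is represented as (A[y])[x]: the outer variable is x, and the coefficients
   are polynomials in y. *)

definition var_x :: "'a :: comm_ring_1 poly poly" where
  "var_x = [:0, 1:]"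

definition var_y :: "'a :: comm_ring_1 poly poly" where
  "var_y = [:[:0, 1:]:]"

definition eval2 :: "'a :: comm_ring_1 poly poly \<Rightarrow> 'a \<Rightarrow> 'a \<Rightarrow> 'a" where
  "eval2 p a b = poly (poly p [:a:]) b"

lemma eval2_simps:
  "eval2 0 a b = 0" "eval2 1 a b = 1" "eval2 var_x a b = a" "eval2 var_y a b = b"
  "eval2 (p - q) a b = eval2 p a b - eval2 q a b"
  "eval2 (p * q) a b = eval2 p a b * eval2 q a b"
  "eval2 (p ^ k) a b = eval2 p a b ^ k"
  by (simp_all add: eval2_def var_x_def var_y_def poly_power)

end

(* A row whose only nonzero entries x, y satisfy x s + y t = 1 can be turned into a unit row by a
   column operation in SL_2 on two columns; clearing below it removes one row and one column, and the
   surviving column of the two is the combination x c_2 - y c_1. For the tridiagonal matrices this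
   is applied from the top downwards and produces the recurrence of f; for a I + b J a few
   transvections leave a single such step. For the cycle the eliminated rows form an arc that
   grows alternately to the right and to the left from its midpoint. The two surviving columns are
   C u and C v, where u and v solve the equations of the eliminated rows; by the symmetry of
   the growth they have entries f_q and b f_{q-1} at the ends of the arc, so the last 2 x 2 block
   can be read off. *)

theory Submission
  imports Defs
begin

section \<open>Operations of determinant one\<close>

text \<open>In the Leibniz expansion, a row other than \<open>p\<close> and \<open>q\<close> has its
  only possibly nonzero entry on the diagonal. So only the identity and the transposition of
  \<open>p\<close> and \<open>q\<close> contribute, and they give the two terms of a 2 x 2
  determinant, whatever the order and the distance of \<open>p\<close> and \<open>q\<close>.\<close>

lemma det_two_column_block:
  fixes s t s' t' :: "'a :: comm_ring_1"
  assumes pq: "p < n" "q < n" "p \<noteq> q"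
  shows "det (mat n n (\<lambda>(i, j).
           if j = p then (if i = p then s else if i = q then t else 0)
           else if j = q then (if i = p then s' else if i = q then t' else 0)
           else if i = j then 1 else 0)) = s * t' - t * s'" (is "det ?A = _")
proof -
  let ?U = "{0..<n}"
  let ?g = "\<lambda>\<pi>. signof \<pi> * (\<Prod>i = 0..<n. ?A $$ (i, \<pi> i)) :: 'a"
  let ?\<tau> = "transpose p q"
  have split: "(\<Prod>i\<in>?U. h i) = h p * h q * (\<Prod>i\<in>?U - {p, q}. h i)" for h :: "nat \<Rightarrow> 'a"
    using prod.subset_diff[of "{p, q}" ?U h] pq by (simp add: mult.commute)
  have "det ?A = (\<Sum>\<pi> | \<pi> permutes ?U. ?g \<pi>)"
    by (rule det_def') simp
  also have "\<dots> = (\<Sum>\<pi> \<in> {id, ?\<tau>}. ?g \<pi>)"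
  proof (rule sum.mono_neutral_right)
    show "\<forall>\<pi> \<in> {\<pi>. \<pi> permutes ?U} - {id, ?\<tau>}. ?g \<pi> = 0"
    proof
      fix \<pi> assume "\<pi> \<in> {\<pi>. \<pi> permutes ?U} - {id, ?\<tau>}"
      then have \<pi>: "\<pi> permutes ?U" and ne: "\<pi> \<noteq> id" "\<pi> \<noteq> ?\<tau>" by auto
      have "\<exists>i<n. ?A $$ (i, \<pi> i) = 0"
      proof (rule ccontr)
        assume "\<not> ?thesis"
        then have nz: "\<And>i. i < n \<Longrightarrow> ?A $$ (i, \<pi> i) \<noteq> 0" by blast
        have lt: "\<pi> i < n" if "i < n" for i
          using permutes_in_image[OF \<pi>, of i] that by simp
        have A_id: "\<pi> i = i" if "i \<noteq> p" "i \<noteq> q" for i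
        proof (cases "i < n")
          case True
          then show ?thesis using nz[OF True] lt[OF True] that by (auto split: if_splits)
        next
          case False
          then show ?thesis using permutes_not_in[OF \<pi>, of i] by simp
        qed
        have inj: "inj \<pi>" by (rule permutes_inj[OF \<pi>])
        \<comment> \<open>If \<open>p\<close> went to an index outside {p, q}, that index would be a
          fixed point with two preimages.\<close>
        have "\<pi> p \<in> {p, q}" "\<pi> q \<in> {p, q}"
          using A_id[of "\<pi> p"] A_id[of "\<pi> q"] injD[OF inj] by blast+
        then consider "\<pi> p = p" "\<pi> q = q" | "\<pi> p = q" "\<pi> q = p"
          using injD[OF inj, of p q] pq(3) by auto
        then have "\<pi> = id \<or> \<pi> = ?\<tau>"
        proof cases
          case 1
          then have "\<pi> i = id i" for i using A_id[of i] by auto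
          then show ?thesis by blast
        next
          case 2
          then have "\<pi> i = ?\<tau> i" for i using A_id[of i] by (auto simp: transpose_def)
          then show ?thesis by blast
        qed
        then show False using ne by blast
      qed
      then have "(\<Prod>i\<in>?U. ?A $$ (i, \<pi> i)) = 0"
        by (auto intro!: prod_zero)
      then show "?g \<pi> = 0" by simp
    qed
  qed (use pq in \<open>auto simp: finite_permutations permutes_id permutes_swap_id\<close>)
  also have "\<dots> = ?g id + ?g ?\<tau>"
  proof -
    have "id \<noteq> ?\<tau>" using pq(3) by (metis id_apply transpose_apply_first)
    then show ?thesis by simp
  qed
  also have "?g id = s * t'"
    unfolding split using pq by (simp add: sign_id)
  also have "?g ?\<tau> = - (t * s')"
    unfolding split using pq by (simp add: sign_swap_id mult.commute)
  finally show ?thesis by simp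
qed

section \<open>Matrices given by entry functions, and the equivalence relation\<close>

abbreviation fun_mat :: "nat \<Rightarrow> (nat \<Rightarrow> nat \<Rightarrow> 'a) \<Rightarrow> 'a mat" where
  "fun_mat n F \<equiv> mat n n (\<lambda>(i, j). F i j)"

lemma fun_mat_eqI:
  assumes "\<And>i j. i < n \<Longrightarrow> j < n \<Longrightarrow> F i j = G i j"
  shows "fun_mat n F = fun_mat n G"
  using assms by (intro eq_matI) auto

lemma one_mat_SL: "1\<^sub>m n \<in> SL n"
  by (simp add: SL_def)

lemma unitary_equivalent_trans [trans]:
  assumes "unitary_equivalent n A B" "unitary_equivalent n B C"
  shows "unitary_equivalent n A C"
proof -
  obtain P Q P' Q' where *: "P \<in> SL n" "Q \<in> SL n" "A = P * B * Q"
    "P' \<in> SL n" "Q' \<in> SL n" "B = P' * C * Q'"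
    and AC: "A \<in> carrier_mat n n" "C \<in> carrier_mat n n"
    using assms unfolding unitary_equivalent_def by blast
  then have c: "P \<in> carrier_mat n n" "Q \<in> carrier_mat n n"
    "P' \<in> carrier_mat n n" "Q' \<in> carrier_mat n n"
    by (auto simp: SL_def)
  have "A = (P * P') * C * (Q' * Q)"
    using * c AC by (simp add: assoc_mult_mat[of _ n n _ n _ n] mult_carrier_mat[of _ n n _ n])
  moreover have "P * P' \<in> SL n" "Q' * Q \<in> SL n"
    using * c by (auto simp: SL_def det_mult)
  ultimately show ?thesis using AC unfolding unitary_equivalent_def by blast
qed

lemma unitary_equivalent_transpose:
  assumes "unitary_equivalent n A B"
  shows "unitary_equivalent n (transpose_mat A) (transpose_mat B)"
proof -
  obtain P Q where *: "P \<in> SL n" "Q \<in> SL n" "A = P * B * Q"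
    and AB: "A \<in> carrier_mat n n" "B \<in> carrier_mat n n"
    using assms unfolding unitary_equivalent_def by blast
  then have c: "P \<in> carrier_mat n n" "Q \<in> carrier_mat n n" by (auto simp: SL_def)
  have "transpose_mat A = transpose_mat Q * (transpose_mat B * transpose_mat P)"
    using * c AB by (simp add: transpose_mult[of _ n n _ n] mult_carrier_mat[of _ n n _ n])
  then have "transpose_mat A = transpose_mat Q * transpose_mat B * transpose_mat P"
    using c AB by (simp add: assoc_mult_mat[of _ n n _ n _ n])
  moreover have "transpose_mat Q \<in> SL n" "transpose_mat P \<in> SL n"
    using * c by (auto simp: SL_def det_transpose)
  ultimately show ?thesis using AB unfolding unitary_equivalent_def
    by (meson transpose_carrier_mat)
qed

text \<open>The adjugate is the inverse when the determinant is 1, and multiplicativity gives it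
  determinant 1 as well.\<close>

lemma SL_inverse:
  assumes "P \<in> SL n"
  obtains P' where "P' \<in> SL n" "P * P' = 1\<^sub>m n" "P' * P = 1\<^sub>m n"
proof -
  have P: "P \<in> carrier_mat n n" "det P = 1" using assms by (auto simp: SL_def)
  note adj = adj_mat[OF P(1)]
  have "det P * det (adj_mat P) = 1"
    using arg_cong[OF adj(2), of det] P adj(1) by (simp add: det_mult[OF P(1) adj(1)])
  then have "adj_mat P \<in> SL n" using P adj(1) by (simp add: SL_def)
  moreover have "(1 :: 'a) \<cdot>\<^sub>m 1\<^sub>m n = 1\<^sub>m n" by (intro eq_matI) auto
  ultimately show ?thesis using that adj P(2) by auto
qed

lemma unitary_equivalent_sym:
  assumes "unitary_equivalent n A B"
  shows "unitary_equivalent n B A"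
proof -
  obtain P Q where *: "P \<in> SL n" "Q \<in> SL n" "A = P * B * Q"
    and AB: "A \<in> carrier_mat n n" "B \<in> carrier_mat n n"
    using assms unfolding unitary_equivalent_def by blast
  obtain P' where P': "P' \<in> SL n" "P' * P = 1\<^sub>m n" using SL_inverse[OF *(1)] by blast
  obtain Q' where Q': "Q' \<in> SL n" "Q * Q' = 1\<^sub>m n" using SL_inverse[OF *(2)] by blast
  have c: "P \<in> carrier_mat n n" "Q \<in> carrier_mat n n"
    "P' \<in> carrier_mat n n" "Q' \<in> carrier_mat n n" using * P' Q' by (auto simp: SL_def)
  have "P' * A * Q' = (P' * P) * B * (Q * Q')"
    using *(3) c AB by (simp add: assoc_mult_mat[of _ n n _ n _ n] mult_carrier_mat[of _ n n _ n])
  then have "B = P' * A * Q'" using P' Q' AB by simp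
  then show ?thesis using AB P' Q' unfolding unitary_equivalent_def by blast
qed

lemma unitary_equivalent_refl:
  assumes "A \<in> carrier_mat n n"
  shows "unitary_equivalent n A A"
  unfolding unitary_equivalent_def using assms one_mat_SL[of n]
  by (metis left_mult_one_mat right_mult_one_mat)

lemma unitary_equivalent_fun_matI:
  assumes "\<And>i j. i < n \<Longrightarrow> j < n \<Longrightarrow> F i j = G i j"
  shows "unitary_equivalent n (fun_mat n F) (fun_mat n G)"
  using fun_mat_eqI[of n F G, OF assms] unitary_equivalent_refl[of "fun_mat n G" n] by simp

text \<open>Multiplication from the right by an SL_2 block placed in rows and columns
  \<open>p\<close>, \<open>q\<close>. Keeping the four coefficients general covers transvections,
  signed swaps and the Bezout step of a pivot at once.\<close>

lemma col_op:
  fixes F :: "nat \<Rightarrow> nat \<Rightarrow> 'a :: comm_ring_1"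
  assumes pq: "p < n" "q < n" "p \<noteq> q" and det: "s * t' - t * s' = 1"
  shows "unitary_equivalent n (fun_mat n F)
    (fun_mat n (\<lambda>i j. if j = p then F i p * s + F i q * t
                       else if j = q then F i p * s' + F i q * t' else F i j))"
    (is "unitary_equivalent n ?F ?G")
\<comment> \<open>The product \<open>?G = ?F * ?Q\<close> expresses the new matrix through the old
  one, which is the relation in the opposite direction.\<close>
proof (rule unitary_equivalent_sym)
  let ?Q = "mat n n (\<lambda>(i, j).
           if j = p then (if i = p then s else if i = q then t else 0)
           else if j = q then (if i = p then s' else if i = q then t' else 0)
           else if i = j then 1 else 0)"
  have sum2: "(\<Sum>k<n. if k = p then F i p * x else if k = q then F i q * y else 0)
      = F i p * x + F i q * y" for i x y
  proof -
    have "(\<Sum>k<n. if k = p then F i p * x else if k = q then F i q * y else 0)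
        = (\<Sum>k<n. (if k = p then F i k * x else 0) + (if k = q then F i k * y else 0))"
      by (rule sum.cong) (use pq in auto)
    also have "\<dots> = F i p * x + F i q * y" using pq by (simp add: sum.distrib)
    finally show ?thesis .
  qed
  have "?G = ?F * ?Q"
  proof (intro eq_matI)
    fix i j assume "i < dim_row (?F * ?Q)" "j < dim_col (?F * ?Q)"
    then have ij: "i < n" "j < n" by auto
    have "(?F * ?Q) $$ (i, j) = (\<Sum>k<n. F i k *
           (if j = p then (if k = p then s else if k = q then t else 0)
           else if j = q then (if k = p then s' else if k = q then t' else 0)
           else if k = j then 1 else 0))"
      using ij by (simp add: scalar_prod_def lessThan_atLeast0)
    also have "\<dots> = ?G $$ (i, j)"
      using ij pq by (simp add: sum2 if_distrib[of "\<lambda>x. _ * x"] sum.delta cong: if_cong)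
    finally show "?G $$ (i, j) = (?F * ?Q) $$ (i, j)" by simp
  qed auto
  then have "?G = 1\<^sub>m n * ?F * ?Q" by simp
  moreover have "?Q \<in> SL n"
    unfolding SL_def using det_two_column_block[OF pq, of s t s' t'] det by simp
  moreover have "?F \<in> carrier_mat n n" "?G \<in> carrier_mat n n" by simp_all
  ultimately show "unitary_equivalent n ?G ?F"
    unfolding unitary_equivalent_def using one_mat_SL[of n] by blast
qed

lemma transpose_fun_mat: "transpose_mat (fun_mat n F) = fun_mat n (\<lambda>i j. F j i)"
  by (intro eq_matI) auto

lemma row_op:
  fixes F :: "nat \<Rightarrow> nat \<Rightarrow> 'a :: comm_ring_1"
  assumes pq: "p < n" "q < n" "p \<noteq> q" and det: "s * t' - t * s' = 1"
  shows "unitary_equivalent n (fun_mat n F)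
    (fun_mat n (\<lambda>i j. if i = p then F p j * s + F q j * t
                       else if i = q then F p j * s' + F q j * t' else F i j))"
  using unitary_equivalent_transpose[OF col_op[OF assms, of "\<lambda>i j. F j i"]]
  by (simp add: transpose_fun_mat)

lemma add_rows_to_row:
  fixes F :: "nat \<Rightarrow> nat \<Rightarrow> 'a :: comm_ring_1"
  assumes "finite T" "T \<subseteq> {..<n}" "r < n" "r \<notin> T"
  shows "unitary_equivalent n (fun_mat n F)
    (fun_mat n (\<lambda>i j. if i = r then F r j + (\<Sum>k\<in>T. c k * F k j) else F i j))"
  using assms
proof (induction T rule: finite_induct)
  case empty
  show ?case by (rule unitary_equivalent_fun_matI) simp
next
  case (insert k T)
  let ?G = "\<lambda>i j. if i = r then F r j + (\<Sum>k\<in>T. c k * F k j) else F i j"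
  have "unitary_equivalent n (fun_mat n F) (fun_mat n ?G)"
    using insert by simp
  also have "unitary_equivalent n (fun_mat n ?G)
    (fun_mat n (\<lambda>i j. if i = r then F r j + (\<Sum>k\<in>insert k T. c k * F k j) else F i j))"
  proof -
    have "unitary_equivalent n (fun_mat n ?G)
      (fun_mat n (\<lambda>i j. if i = r then ?G r j * 1 + ?G k j * c k
                         else if i = k then ?G r j * 0 + ?G k j * 1 else ?G i j))"
      by (rule row_op) (use insert.prems in auto)
    moreover have "fun_mat n (\<lambda>i j. if i = r then ?G r j * 1 + ?G k j * c k
                         else if i = k then ?G r j * 0 + ?G k j * 1 else ?G i j) =
      fun_mat n (\<lambda>i j. if i = r then F r j + (\<Sum>k\<in>insert k T. c k * F k j) else F i j)"
      by (rule fun_mat_eqI) (use insert in \<open>auto simp: algebra_simps\<close>)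
    ultimately show ?thesis by simp
  qed
  finally show ?case .
qed

text \<open>The target rows are treated one at a time. Since \<open>S\<close> and \<open>T\<close>
  are disjoint, the source rows keep their original values throughout, so all the sums may be
  written with \<open>F\<close>.\<close>

lemma add_rows_to_rows:
  fixes F :: "nat \<Rightarrow> nat \<Rightarrow> 'a :: comm_ring_1"
  assumes "finite S" "S \<subseteq> {..<n}" "T \<subseteq> {..<n}" "S \<inter> T = {}"
  shows "unitary_equivalent n (fun_mat n F)
    (fun_mat n (\<lambda>i j. if i \<in> S then F i j + (\<Sum>k\<in>T. c i k * F k j) else F i j))"
  using assms
proof (induction S rule: finite_induct)
  case empty
  show ?case by (rule unitary_equivalent_fun_matI) simp
next
  case (insert r S)
  let ?G = "\<lambda>i j. if i \<in> S then F i j + (\<Sum>k\<in>T. c i k * F k j) else F i j"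
  have "unitary_equivalent n (fun_mat n F) (fun_mat n ?G)"
    using insert by simp
  also have "unitary_equivalent n (fun_mat n ?G)
     (fun_mat n (\<lambda>i j. if i = r then ?G r j + (\<Sum>k\<in>T. c r k * ?G k j) else ?G i j))"
    by (rule add_rows_to_row) (use insert.prems in \<open>auto intro: finite_subset\<close>)
  also have "unitary_equivalent n \<dots>
     (fun_mat n (\<lambda>i j. if i \<in> insert r S then F i j + (\<Sum>k\<in>T. c i k * F k j) else F i j))"
  proof (rule unitary_equivalent_fun_matI, goal_cases)
    case (1 i j)
    have "(\<Sum>k\<in>T. c r k * ?G k j) = (\<Sum>k\<in>T. c r k * F k j)"
      by (rule sum.cong) (use insert.prems in auto)
    then show ?case using insert.hyps by simp
  qed
  finally show ?case .
qed

lemma add_cols_to_cols: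
  fixes F :: "nat \<Rightarrow> nat \<Rightarrow> 'a :: comm_ring_1"
  assumes "finite S" "S \<subseteq> {..<n}" "T \<subseteq> {..<n}" "S \<inter> T = {}"
  shows "unitary_equivalent n (fun_mat n F)
    (fun_mat n (\<lambda>i j. if j \<in> S then F i j + (\<Sum>k\<in>T. c j k * F i k) else F i j))"
  using unitary_equivalent_transpose[OF add_rows_to_rows[OF assms, of "\<lambda>i j. F j i" c]]
  by (simp add: transpose_fun_mat)

text \<open>The column operation with coefficient columns (s, t) and (- F p q, F p p) has
  determinant F p p * s + F p q * t = 1 and makes row \<open>p\<close> a unit row. Multiples of that
  row then clear column \<open>p\<close> without touching any other column.\<close>

lemma pivot:
  fixes F :: "nat \<Rightarrow> nat \<Rightarrow> 'a :: comm_ring_1"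
  assumes pq: "p < n" "q < n" "p \<noteq> q"
    and unimodular: "\<exists>s t. F p p * s + F p q * t = 1"
    and zero: "\<And>j. j < n \<Longrightarrow> j \<noteq> p \<Longrightarrow> j \<noteq> q \<Longrightarrow> F p j = 0"
  shows "unitary_equivalent n (fun_mat n F)
    (fun_mat n (\<lambda>i j. if i = p \<or> j = p then (if i = j then 1 else 0)
       else if j = q then F p p * F i q - F p q * F i p else F i j))"
proof -
  obtain s t where st: "F p p * s + F p q * t = 1" using unimodular by blast
  let ?G = "\<lambda>i j. if j = p then F i p * s + F i q * t
                  else if j = q then F i p * (- F p q) + F i q * F p p else F i j"
  have "unitary_equivalent n (fun_mat n F) (fun_mat n ?G)"
    by (rule col_op) (use pq st in \<open>auto simp: algebra_simps\<close>)
  also have "unitary_equivalent n \<dots> (fun_mat n (\<lambda>i j. if i \<in> {..<n} - {p}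
      then ?G i j + (\<Sum>k\<in>{p}. - ?G i p * ?G k j) else ?G i j))"
    by (rule add_rows_to_rows) (use pq in auto)
  also have "unitary_equivalent n \<dots> (fun_mat n (\<lambda>i j. if i = p \<or> j = p
      then (if i = j then 1 else 0)
      else if j = q then F p p * F i q - F p q * F i p else F i j))"
    by (rule unitary_equivalent_fun_matI) (use pq st zero in \<open>auto; simp add: algebra_simps\<close>)
  finally show ?thesis .
qed

section \<open>Paths and complete graphs\<close>

abbreviation (input) comaximal :: "'a :: comm_ring_1 \<Rightarrow> 'a \<Rightarrow> bool" where
  "comaximal x y \<equiv> \<exists>s t. x * s + y * t = 1"

text \<open>Modulo \<open>z\<close> both \<open>x\<close> and \<open>y\<close> are units, hence so
  is their product, and \<open>z * w\<close> vanishes there. Multiplying the two Bezout relations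
  gives the explicit coefficients.\<close>

lemma comaximal_mult_add:
  fixes x y z w :: "'a :: comm_ring_1"
  assumes "comaximal x z" "comaximal y z"
  shows "comaximal (x * y - z * w) z"
proof -
  obtain s t s' t' where st: "x * s + z * t = 1" "y * s' + z * t' = 1"
    using assms by blast
  have "(x * y - z * w) * (s * s') + z * (w * s * s' + x * s * t' + t * (y * s' + z * t'))
      = (x * s + z * t) * (y * s' + z * t')"
    by (simp add: algebra_simps)
  then show ?thesis using st by (metis mult_1_left)
qed

text \<open>Modulo \<open>b\<close> the recurrence reduces to multiplication by the unit
  \<open>a\<close>. This keeps every pivot row of the eliminations unimodular.\<close>

lemma comaximal_recurrence:
  fixes h :: "nat \<Rightarrow> 'a :: comm_ring_1"
  assumes "comaximal a b" "comaximal (h 0) b" "comaximal (h 1) b"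
    and rec: "\<And>k. h (Suc (Suc k)) = a * h (Suc k) - b ^ 2 * h k"
  shows "comaximal (h k) b"
proof -
  have "comaximal (h k) b \<and> comaximal (h (Suc k)) b"
  proof (induction k)
    case (Suc k)
    then have "comaximal (a * h (Suc k) - b * (b * h k)) b"
      using comaximal_mult_add[of a b "h (Suc k)" "b * h k"] assms(1) by blast
    then show ?case using Suc rec[of k] by (simp add: power2_eq_square mult.assoc)
  qed (use assms in simp)
  then show ?thesis ..
qed

text \<open>Free first and last diagonal entries let one elimination serve both \<open>T_mat\<close>
  (c = d = a) and \<open>P_mat\<close> (c = d = a + b).\<close>

definition tridiagonal :: "nat \<Rightarrow> 'a \<Rightarrow> 'a \<Rightarrow> 'a \<Rightarrow> 'a \<Rightarrow> nat \<Rightarrow> nat \<Rightarrow> 'a :: comm_ring_1" where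
  "tridiagonal n c a d b i j =
     (if i = j then (if i = 0 then c else if i = n - 1 then d else a)
      else if i = Suc j \<or> j = Suc i then b else 0)"

text \<open>For k < n, \<open>h k\<close> is the leading principal minor of size k, and the last
  diagonal entry of the result is the determinant of the whole matrix. Pivoting from the top
  produces these minors one after the other.\<close>

lemma tridiagonal_equivalent:
  fixes a b c d :: "'a :: comm_ring_1"
  assumes n: "n \<ge> 2" and ab: "comaximal a b" and cb: "comaximal c b"
    and h: "h 0 = 1" "h 1 = c" "\<And>k. h (Suc (Suc k)) = a * h (Suc k) - b ^ 2 * h k"
  shows "unitary_equivalent n (fun_mat n (tridiagonal n c a d b))
    (mat_diag n (\<lambda>i. if i = n - 1 then d * h (n - 1) - b ^ 2 * h (n - 2) else 1))"
proof -
  let ?T = "tridiagonal n c a d b"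
  \<comment> \<open>\<open>?N k\<close> is the matrix after k pivots. Its column k has been replaced
    by a combination with \<open>h (Suc k)\<close> on the diagonal and \<open>b * h k\<close> below;
    row k then has only the comaximal entries \<open>h (Suc k)\<close> and \<open>b\<close>.\<close>
  let ?N = "\<lambda>k i j. if i < k \<or> j < k then (if i = j then 1 else 0)
     else if j = k then (if i = k then h (Suc k) else if i = Suc k then b * h k else 0)
     else ?T i j"
  have "comaximal (h 0) b" unfolding h(1) by (intro exI[of _ 1] exI[of _ 0]) simp
  then have hb: "comaximal (h k) b" for k
    using comaximal_recurrence[of a b h k] ab cb h by simp
  have "unitary_equivalent n (fun_mat n ?T) (fun_mat n (?N k))" if "k \<le> n - 2" for k
    using that
  proof (induction k)
    case 0
    show ?case
      by (rule unitary_equivalent_fun_matI) (use n h in \<open>auto simp: tridiagonal_def\<close>)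
  next
    case (Suc k)
    then have "unitary_equivalent n (fun_mat n ?T) (fun_mat n (?N k))" by simp
    also have "unitary_equivalent n (fun_mat n (?N k))
      (fun_mat n (\<lambda>i j. if i = k \<or> j = k then (if i = j then 1 else 0)
       else if j = Suc k then ?N k k k * ?N k i (Suc k) - ?N k k (Suc k) * ?N k i k else ?N k i j))"
      by (rule pivot) (use Suc.prems n hb[of "Suc k"] in \<open>auto simp: tridiagonal_def\<close>)
    also have "unitary_equivalent n \<dots> (fun_mat n (?N (Suc k)))"
      by (rule unitary_equivalent_fun_matI)
        (use Suc.prems n in \<open>auto simp: tridiagonal_def h(3) algebra_simps power2_eq_square\<close>)
    finally show ?case .
  qed
  then have "unitary_equivalent n (fun_mat n ?T) (fun_mat n (?N (n - 2)))" by simp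
  \<comment> \<open>The last pivot stands apart because the diagonal entry that it meets is
    \<open>d\<close> instead of \<open>a\<close>.\<close>
  also have "unitary_equivalent n (fun_mat n (?N (n - 2)))
      (fun_mat n (\<lambda>i j. if i = n - 2 \<or> j = n - 2 then (if i = j then 1 else 0)
       else if j = n - 1 then ?N (n - 2) (n - 2) (n - 2) * ?N (n - 2) i (n - 1)
         - ?N (n - 2) (n - 2) (n - 1) * ?N (n - 2) i (n - 2) else ?N (n - 2) i j))"
    by (rule pivot) (use n hb[of "Suc (n - 2)"] in \<open>auto simp: tridiagonal_def\<close>)
  also have "unitary_equivalent n \<dots>
      (mat_diag n (\<lambda>i. if i = n - 1 then d * h (n - 1) - b ^ 2 * h (n - 2) else 1))"
  proof -
    obtain m where m: "n = Suc (Suc m)"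
      using n by (metis One_nat_def Suc_le_D Suc_le_mono numeral_2_eq_2)
    show ?thesis unfolding mat_diag_def
      by (rule unitary_equivalent_fun_matI)
        (auto simp: m tridiagonal_def algebra_simps power2_eq_square)
  qed
  finally show ?thesis .
qed

section \<open>The graph matrices in terms of their entries, and the complete graph\<close>

lemma mem_path_edges: "{i, j} \<in> path_edges n \<longleftrightarrow> (j = Suc i \<and> j < n) \<or> (i = Suc j \<and> i < n)"
  by (auto simp: path_edges_def doubleton_eq_iff)

lemma T_mat_eq: "T_mat n a b = fun_mat n (tridiagonal n a a a b)"
  by (intro eq_matI) (auto simp: T_mat_def adjacency_matrix_def mem_path_edges tridiagonal_def)

lemma P_mat_eq: "n \<ge> 2 \<Longrightarrow> P_mat n a b = fun_mat n (tridiagonal n (a + b) a (a + b) b)"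
  by (intro eq_matI) (auto simp: P_mat_def T_mat_eq mat_diag_def tridiagonal_def)

lemma K_mat_eq: "K_mat n a b = fun_mat n (\<lambda>i j. if i = j then a + b else b)"
  by (intro eq_matI)
    (auto simp: K_mat_def adjacency_matrix_def complete_edges_def doubleton_eq_iff)

lemma K_mat_equivalent:
  fixes a b :: "'a :: comm_ring_1"
  assumes n: "n \<ge> 2" and ab: "comaximal a b"
  shows "unitary_equivalent n (K_mat n a b)
    (mat_diag n (\<lambda>i. if i = 0 then 1 else if i = n - 1 then a * (a + of_nat n * b) else a))"
proof -
  let ?l = "n - 1"
  let ?K = "\<lambda>i j. if i = j then a + b else b"
  let ?A = "\<lambda>i j. if i = ?l then a + of_nat n * b else ?K i j"
  let ?B = "\<lambda>i j. if i = j then (if i = ?l then a + of_nat n * b else a)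
                  else if j = ?l then b else 0"
  let ?D = "\<lambda>i j. if i = j then (if i = ?l then a + of_nat n * b else a)
                  else if j = ?l \<and> i = 0 then b else 0"
  \<comment> \<open>Every column sum equals \<open>a + of_nat n * b\<close>, so adding all other
    rows to the last makes the last row constant.\<close>
  have "unitary_equivalent n (fun_mat n ?K)
      (fun_mat n (\<lambda>i j. if i \<in> {?l} then ?K i j + (\<Sum>k\<in>{..<?l}. 1 * ?K k j) else ?K i j))"
    by (rule add_rows_to_rows) (use n in auto)
  also have "unitary_equivalent n \<dots> (fun_mat n ?A)"
  proof (rule unitary_equivalent_fun_matI, goal_cases)
    case (1 i j)
    have "(\<Sum>k<n. ?K k j) = (\<Sum>k<n. b + (if k = j then a else 0))"
      by (rule sum.cong) auto
    also have "\<dots> = a + of_nat n * b" using 1 by (simp add: sum.distrib)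
    finally have "(\<Sum>k<Suc ?l. ?K k j) = a + of_nat n * b" using n by simp
    then show ?case by (simp add: add.commute)
  qed
  \<comment> \<open>Subtracting the last column from the others leaves a diagonal matrix, apart from
    entries \<open>b\<close> in the last column above the corner.\<close>
  also have "unitary_equivalent n \<dots>
      (fun_mat n (\<lambda>i j. if j \<in> {..<?l} then ?A i j + (\<Sum>k\<in>{?l}. - 1 * ?A i k) else ?A i j))"
    by (rule add_cols_to_cols) (use n in auto)
  also have "unitary_equivalent n \<dots> (fun_mat n ?B)"
    by (rule unitary_equivalent_fun_matI) auto
  \<comment> \<open>Row 0 cancels the \<open>b\<close> of the middle rows at the price of entries
    \<open>- a\<close> in column 0, which the middle columns then remove.\<close>
  also have "unitary_equivalent n \<dots>
      (fun_mat n (\<lambda>i j. if i \<in> {0<..<?l} then ?B i j + (\<Sum>k\<in>{0}. - 1 * ?B k j) else ?B i j))"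
    by (rule add_rows_to_rows) (use n in auto)
  also have "unitary_equivalent n \<dots>
      (fun_mat n (\<lambda>i j. if j \<in> {0<..<?l} then (if i = j then a else 0)
         else if j = 0 \<and> i \<in> {0<..<?l} then - a else ?D i j))"
    (is "unitary_equivalent n _ (fun_mat n ?C)")
    by (rule unitary_equivalent_fun_matI) (use n in auto)
  also have "unitary_equivalent n \<dots>
      (fun_mat n (\<lambda>i j. if j \<in> {0} then ?C i j + (\<Sum>k\<in>{0<..<?l}. 1 * ?C i k) else ?C i j))"
    by (rule add_cols_to_cols) (use n in auto)
  also have "unitary_equivalent n \<dots> (fun_mat n ?D)"
  proof (rule unitary_equivalent_fun_matI, goal_cases)
    case (1 i j)
    have "(\<Sum>k\<in>{0<..<?l}. 1 * ?C i k) = (\<Sum>k\<in>{0<..<?l}. if k = i then a else 0)"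
      by (rule sum.cong) auto
    also have "\<dots> = (if i \<in> {0<..<?l} then a else 0)" by simp
    finally have "(\<Sum>k\<in>{0<..<?l}. 1 * ?C i k) = (if i \<in> {0<..<?l} then a else 0)" .
    then show ?case using n 1 by auto
  qed
  \<comment> \<open>Row 0 now consists of \<open>a\<close> in column 0 and \<open>b\<close> in the
    last column. Pivoting on it multiplies the last diagonal entry by \<open>a\<close>.\<close>
  also have "unitary_equivalent n \<dots>
      (fun_mat n (\<lambda>i j. if i = 0 \<or> j = 0 then (if i = j then 1 else 0)
       else if j = ?l then ?D 0 0 * ?D i ?l - ?D 0 ?l * ?D i 0 else ?D i j))"
    by (rule pivot) (use n ab in auto)
  also have "unitary_equivalent n \<dots>
      (mat_diag n (\<lambda>i. if i = 0 then 1 else if i = n - 1 then a * (a + of_nat n * b) else a))"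
    unfolding mat_diag_def by (rule unitary_equivalent_fun_matI) (use n in auto)
  finally show ?thesis unfolding K_mat_eq .
qed

section \<open>Elimination along an arc of the cycle\<close>

text \<open>A state of the elimination: \<open>A\<close> holds the indices already split off, and
  \<open>p\<close>, \<open>r\<close> are the ends of the arc. Recording their columns by coefficient
  vectors reduces every later entry to the product of a row of \<open>F\<close> with
  \<open>u\<close> or \<open>v\<close>.\<close>

definition eliminated ::
  "nat \<Rightarrow> (nat \<Rightarrow> nat \<Rightarrow> 'a) \<Rightarrow> nat set \<Rightarrow> nat \<Rightarrow> (nat \<Rightarrow> 'a) \<Rightarrow> nat \<Rightarrow> (nat \<Rightarrow> 'a) \<Rightarrow>
    nat \<Rightarrow> nat \<Rightarrow> 'a :: comm_ring_1"
  where
  "eliminated n F A p u r v i j =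
     (if i \<in> A \<or> j \<in> A then (if i = j then 1 else 0)
      else if j = p then (\<Sum>k<n. F i k * u k)
      else if j = r then (\<Sum>k<n. F i k * v k) else F i j)"

lemma eliminated_commute: "p \<noteq> r \<Longrightarrow> eliminated n F A p u r v = eliminated n F A r v p u"
  by (auto simp: eliminated_def fun_eq_iff)

lemma eliminated_empty:
  assumes "p < n" "r < n"
  shows "eliminated n F {} p (\<lambda>k. if k = p then 1 else 0) r (\<lambda>k. if k = r then 1 else 0) = F"
proof -
  have "(\<Sum>k<n. F i k * (if k = s then 1 else 0)) = F i s" if "s < n" for i s
    using that by (simp add: if_distrib[of "\<lambda>x. _ * x"] cong: if_cong)
  then show ?thesis using assms by (auto simp: eliminated_def fun_eq_iff)
qed

text \<open>Outside the eliminated columns, row \<open>r\<close> of the state can be nonzero only at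
  \<open>p\<close>, \<open>r\<close> and \<open>q\<close>, with entries \<open>F r q * e\<close>,
  \<open>c\<close> and \<open>F r q\<close>. Subtracting \<open>e\<close> times column
  \<open>q\<close> clears the first one, and the other two are comaximal, so a pivot applies. The
  end of the arc moves from \<open>r\<close> to \<open>q\<close>.\<close>

lemma eliminate_row:
  fixes F :: "nat \<Rightarrow> nat \<Rightarrow> 'a :: comm_ring_1"
  assumes lt: "p < n" "r < n" "q < n" and ne: "p \<noteq> r" "p \<noteq> q" "r \<noteq> q"
    and A: "p \<notin> A" "r \<notin> A" "q \<notin> A"
    and zero: "\<And>j. j < n \<Longrightarrow> j \<notin> A \<Longrightarrow> j \<noteq> p \<Longrightarrow> j \<noteq> r \<Longrightarrow> j \<noteq> q \<Longrightarrow> F r j = 0"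
    and u: "(\<Sum>k<n. F r k * u k) = F r q * e"
    and v: "(\<Sum>k<n. F r k * v k) = c" "comaximal c (F r q)"
  shows "unitary_equivalent n (fun_mat n (eliminated n F A p u r v))
    (fun_mat n (eliminated n F (insert r A)
       p (\<lambda>k. u k - (if k = q then e else 0))
       q (\<lambda>k. (if k = q then c else 0) - F r q * v k)))"
proof -
  let ?N = "eliminated n F A p u r v"
  let ?u = "\<lambda>k. u k - (if k = q then e else 0)"
    and ?v = "\<lambda>k. (if k = q then c else 0) - F r q * v k"
  let ?G = "\<lambda>i j. if j \<in> {p} then ?N i j + (\<Sum>k\<in>{q}. - e * ?N i k) else ?N i j"
  have N_A: "?N i j = (if i = j then 1 else 0)" if "i \<in> A \<or> j \<in> A" for i j
    using that by (simp add: eliminated_def)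
  have N: "?N i p = (\<Sum>k<n. F i k * u k)" "?N i r = (\<Sum>k<n. F i k * v k)" "?N i q = F i q"
    if "i \<notin> A" for i
    using that A ne by (simp_all add: eliminated_def)
  have N_other: "?N i j = F i j" if "i \<notin> A" "j \<notin> A" "j \<noteq> p" "j \<noteq> r" for i j
    using that by (simp add: eliminated_def)
  have "unitary_equivalent n (fun_mat n ?N) (fun_mat n ?G)"
    by (rule add_cols_to_cols) (use lt ne in auto)
  also have "unitary_equivalent n \<dots> (fun_mat n (\<lambda>i j. if i = r \<or> j = r then (if i = j then 1 else 0)
       else if j = q then ?G r r * ?G i q - ?G r q * ?G i r else ?G i j))"
  proof (rule pivot)
    show "?G r j = 0" if "j < n" "j \<noteq> r" "j \<noteq> q" for j
    proof (cases "j \<in> A")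
      case True
      then show ?thesis using N_A[of r j] that A by auto
    next
      case False
      then show ?thesis
        using that A zero[of j] u N_other[of r j] N[of r] by (simp add: mult.commute)
    qed
  qed (use lt ne A v N[of r] in auto)
  also have "unitary_equivalent n \<dots> (fun_mat n (eliminated n F (insert r A) p ?u q ?v))"
  proof (rule unitary_equivalent_fun_matI, goal_cases)
    case (1 i j)
    have delta: "(\<Sum>k<n. F i k * (if k = q then x else 0)) = F i q * x" for x
      using lt by (simp add: if_distrib[of "\<lambda>x. _ * x"] cong: if_cong)
    \<comment> \<open>By linearity, the two column operations are the same operations on the
      coefficient vectors.\<close>
    have eqs: "(\<Sum>k<n. F i k * ?u k) = (\<Sum>k<n. F i k * u k) - F i q * e"
      "(\<Sum>k<n. F i k * ?v k) = F i q * c - F r q * (\<Sum>k<n. F i k * v k)"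
      using delta
      by (simp_all add: right_diff_distrib sum_subtractf sum_distrib_left mult.left_commute)
    consider "i = r \<or> j = r" | "i \<noteq> r" "j \<noteq> r" "i \<in> A" | "i \<noteq> r" "j \<noteq> r" "i \<notin> A" "j \<in> A"
      | "i \<noteq> r" "i \<notin> A" "j = p" | "i \<noteq> r" "i \<notin> A" "j = q"
      | "i \<noteq> r" "i \<notin> A" "j \<noteq> r" "j \<notin> A" "j \<noteq> p" "j \<noteq> q"
      by blast
    then show ?case
    proof cases
      case 1
      then show ?thesis by (auto simp: eliminated_def)
    next
      case 2
      then have "i \<noteq> p" "i \<noteq> q" using A by auto
      then show ?thesis using 2 ne A N_A[of i] by (auto simp: eliminated_def)
    next
      case 3
      then have "j \<noteq> p" "j \<noteq> q" using A by auto
      then show ?thesis using 3 N_A[of i j] by (simp add: eliminated_def)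
    next
      case 4
      then show ?thesis using ne A N[of i] eqs by (simp add: eliminated_def mult.commute)
    next
      case 5
      then show ?thesis
        using ne A N[of i] N[of r] v(1) eqs by (simp add: eliminated_def mult.commute)
    next
      case 6
      then show ?thesis using N_other[of i j] by (simp add: eliminated_def)
    qed
  qed
  finally show ?thesis .
qed

text \<open>Intended for size x + 2, where the final case of each index means x + 1: an identity
  block followed by a 2 x 2 block.\<close>

definition corner :: "nat \<Rightarrow> 'a \<Rightarrow> 'a \<Rightarrow> 'a \<Rightarrow> 'a \<Rightarrow> nat \<Rightarrow> nat \<Rightarrow> 'a :: comm_ring_1" where
  "corner x \<alpha> \<beta> \<gamma> \<delta> i j =
     (if i < x \<or> j < x then (if i = j then 1 else 0)
      else if i = x then (if j = x then \<alpha> else \<beta>)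
      else (if j = x then \<gamma> else \<delta>))"

lemma corner_row_op:
  assumes n: "n = x + 2" and det: "s * t' - t * s' = 1"
  shows "unitary_equivalent n (fun_mat n (corner x \<alpha> \<beta> \<gamma> \<delta>))
    (fun_mat n (corner x (\<alpha> * s + \<gamma> * t) (\<beta> * s + \<delta> * t) (\<alpha> * s' + \<gamma> * t') (\<beta> * s' + \<delta> * t')))"
proof -
  let ?F = "corner x \<alpha> \<beta> \<gamma> \<delta>"
  have "unitary_equivalent n (fun_mat n ?F)
    (fun_mat n (\<lambda>i j. if i = x then ?F x j * s + ?F (x + 1) j * t
                      else if i = x + 1 then ?F x j * s' + ?F (x + 1) j * t' else ?F i j))"
    by (rule row_op) (use n det in auto)
  also have "unitary_equivalent n \<dots> (fun_mat n
      (corner x (\<alpha> * s + \<gamma> * t) (\<beta> * s + \<delta> * t) (\<alpha> * s' + \<gamma> * t') (\<beta> * s' + \<delta> * t')))"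
    by (rule unitary_equivalent_fun_matI) (use n in \<open>auto simp: corner_def\<close>)
  finally show ?thesis .
qed

lemma corner_col_op:
  assumes n: "n = x + 2" and det: "s * t' - t * s' = 1"
  shows "unitary_equivalent n (fun_mat n (corner x \<alpha> \<beta> \<gamma> \<delta>))
    (fun_mat n (corner x (\<alpha> * s + \<beta> * t) (\<alpha> * s' + \<beta> * t') (\<gamma> * s + \<delta> * t) (\<gamma> * s' + \<delta> * t')))"
proof -
  have "transpose_mat (fun_mat n (corner x \<alpha> \<beta> \<gamma> \<delta>)) = fun_mat n (corner x \<alpha> \<gamma> \<beta> \<delta>)"
    for \<alpha> \<beta> \<gamma> \<delta> :: 'a
    unfolding transpose_fun_mat by (rule fun_mat_eqI) (auto simp: corner_def)
  then show ?thesis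
    using unitary_equivalent_transpose[OF corner_row_op[OF assms, of \<alpha> \<gamma> \<beta> \<delta>]] by simp
qed

lemma diag_block_mat_corner:
  assumes "n \<ge> 2"
  shows "diag_block_mat [1\<^sub>m (n - 2), c \<cdot>\<^sub>m mat_of_rows_list 2 [[\<alpha>, \<beta>], [\<gamma>, \<delta>]]] =
    fun_mat n (corner (n - 2) (c * \<alpha>) (c * \<beta>) (c * \<gamma>) (c * \<delta>))"
proof -
  obtain x where "n = Suc (Suc x)" using le_Suc_ex[OF assms] by auto
  then show ?thesis
    by (intro eq_matI) (auto simp: Let_def corner_def mat_of_rows_list_def nth_Cons' less_Suc_eq)
qed

text \<open>With all indices below \<open>x\<close> split off, only the two recorded columns remain.
  The vector \<open>v\<close> belongs to index \<open>x\<close>, so its products form the first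
  column of the block.\<close>

lemma eliminated_corner:
  assumes n: "n = x + 2"
  shows "unitary_equivalent n (fun_mat n (eliminated n F {..<x} (x + 1) u x v))
    (fun_mat n (corner x (\<Sum>k<n. F x k * v k) (\<Sum>k<n. F x k * u k)
      (\<Sum>k<n. F (x + 1) k * v k) (\<Sum>k<n. F (x + 1) k * u k)))"
proof (rule unitary_equivalent_fun_matI)
  fix i j assume "i < n" "j < n"
  then have "i < x \<or> i = x \<or> i = x + 1" "j < x \<or> j = x \<or> j = x + 1" using n by linarith+
  then show "eliminated n F {..<x} (x + 1) u x v i j =
    corner x (\<Sum>k<n. F x k * v k) (\<Sum>k<n. F x k * u k)
      (\<Sum>k<n. F (x + 1) k * v k) (\<Sum>k<n. F (x + 1) k * u k) i j"
    by (elim disjE) (simp_all add: eliminated_def corner_def)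
qed

section \<open>The matrix of the cycle and the growth of the arc\<close>

definition cyclic :: "nat \<Rightarrow> 'a \<Rightarrow> 'a \<Rightarrow> nat \<Rightarrow> nat \<Rightarrow> 'a :: comm_ring_1" where
  "cyclic n a b i j =
     (if i = j then a
      else if j = (if i = n - 1 then 0 else i + 1) \<or> j = (if i = 0 then n - 1 else i - 1) then b
      else 0)"

lemma mem_cycle_edges:
  assumes "i < n" "j < n" "n \<ge> 3"
  shows "{i, j} \<in> cycle_edges n \<longleftrightarrow>
    j = (if i = n - 1 then 0 else i + 1) \<or> j = (if i = 0 then n - 1 else i - 1)"
proof -
  have "{i, j} \<in> cycle_edges n \<longleftrightarrow> (j = Suc i \<and> j < n) \<or> (i = Suc j \<and> i < n)
      \<or> (i = n - 1 \<and> j = 0) \<or> (i = 0 \<and> j = n - 1)"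
    unfolding cycle_edges_def Un_iff mem_path_edges singleton_iff doubleton_eq_iff by blast
  also have "\<dots> \<longleftrightarrow> j = (if i = n - 1 then 0 else i + 1) \<or> j = (if i = 0 then n - 1 else i - 1)"
    using assms by auto
  finally show ?thesis .
qed

lemma C_mat_eq:
  assumes "n \<ge> 3"
  shows "C_mat n a b = fun_mat n (cyclic n a b)"
proof (rule eq_matI)
  fix i j assume "i < dim_row (fun_mat n (cyclic n a b))" "j < dim_col (fun_mat n (cyclic n a b))"
  then have ij: "i < n" "j < n" by auto
  have "C_mat n a b $$ (i, j) =
      (if i = j then a else 0) + (if {i, j} \<in> cycle_edges n then b else 0)"
    using ij by (simp add: C_mat_def adjacency_matrix_def)
  also have "\<dots> = cyclic n a b i j"
    unfolding mem_cycle_edges[OF ij assms] cyclic_def using assms ij by auto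
  finally show "C_mat n a b $$ (i, j) = fun_mat n (cyclic n a b) $$ (i, j)"
    using ij by simp
qed (simp_all add: C_mat_def adjacency_matrix_def)

text \<open>For n >= 3 an index and its two neighbours are distinct, so the three contributions do
  not overlap.\<close>

lemma sum_cyclic:
  fixes a b :: "'a :: comm_ring_1"
  assumes "i < n" "n \<ge> 3"
  shows "(\<Sum>k<n. cyclic n a b i k * u k) =
    a * u i + b * u (if i = n - 1 then 0 else i + 1) + b * u (if i = 0 then n - 1 else i - 1)"
proof -
  define s where "s = (if i = n - 1 then 0 else i + 1)"
  define p where "p = (if i = 0 then n - 1 else i - 1)"
  have sp: "s < n" "p < n" "s \<noteq> i" "p \<noteq> i" "s \<noteq> p"
    using assms s_def p_def by (auto split: if_splits)
  have entry: "cyclic n a b i k = (if k = i then a else if k = s \<or> k = p then b else 0)" for k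
    by (simp only: cyclic_def s_def p_def eq_commute[of i k])
  have "(\<Sum>k<n. cyclic n a b i k * u k) = (\<Sum>k<n. (if k = i then a * u i else 0)
      + (if k = s then b * u s else 0) + (if k = p then b * u p else 0))"
    by (rule sum.cong) (use sp entry in auto)
  also have "\<dots> = a * u i + b * u s + b * u p"
    using assms(1) sp by (simp add: sum.distrib)
  finally show ?thesis unfolding s_def p_def .
qed

text \<open>The arc grows \<open>m\<close> times on both sides, which uses up n - 2 rows when n is
  even; when n is odd, one more step to the right is left.\<close>

locale cycle_elimination =
  fixes n m :: nat and a b :: "'a :: comm_ring_1" and g :: "nat \<Rightarrow> 'a"
  assumes m: "m \<ge> 1" and n: "n = 2 * m + 2 \<or> n = 2 * m + 3"
    and ab: "comaximal a b"
    and g: "g 0 = 0" "g 1 = 1" "\<And>k. g (Suc (Suc k)) = a * g (Suc k) - b ^ 2 * g k"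
begin

text \<open>Rows \<open>0, \<dots>, n - 3\<close> get eliminated, so that the identity block comes first. The position
  \<open>-1\<close> left of \<open>0\<close>, reached for \<open>q = m\<close>, is the vertex \<open>n - 1\<close>.\<close>
definition left_end :: "nat \<Rightarrow> nat" where
  "left_end q = (if q < m then m - 1 - q else n - 1)"

definition arc :: "nat \<Rightarrow> nat set" where
  "arc q = {m - q..<m + q}"

text \<open>Here \<open>g k\<close> stands for $f_{k-1}(a,b)$. For \<open>q \<ge> 1\<close>, the two clauses about a
  sum say, after multiplication by \<open>b\<close>, that \<open>u\<close> and \<open>v\<close> have entry $-b^2 f_{q-2}(a,b)$ next to
  their entry $b f_{q-1}(a,b)$; in this form they also hold for the initial unit vectors.\<close>
definition kernel_pair :: "nat \<Rightarrow> (nat \<Rightarrow> 'a) \<Rightarrow> (nat \<Rightarrow> 'a) \<Rightarrow> bool" where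
  "kernel_pair q u v \<longleftrightarrow>
     (\<forall>k. k \<notin> arc q \<longrightarrow> k \<noteq> left_end q \<longrightarrow> k \<noteq> m + q \<longrightarrow> u k = 0 \<and> v k = 0) \<and>
     u (left_end q) = g (Suc q) \<and> u (m - q) = - b * g q \<and>
     u (m + q) = b * g q \<and> b * u (m + q - 1) + a * u (m + q) = b * g (Suc q) \<and>
     v (m + q) = g (Suc q) \<and> v (m + q - 1) = - b * g q \<and>
     v (left_end q) = b * g q \<and> b * v (m - q) + a * v (left_end q) = b * g (Suc q)"

abbreviation reduced where
  "reduced q u v \<equiv> fun_mat n (eliminated n (cyclic n a b) (arc q) (left_end q) u (m + q) v)"

lemma comaximal_g: "comaximal (g (Suc k)) b"
proof (rule comaximal_recurrence[of a b "\<lambda>k. g (Suc k)"])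
  show "comaximal (g (Suc 0)) b" using g(2) by (intro exI[of _ 1] exI[of _ 0]) simp
  show "comaximal (g (Suc 1)) b" using g ab by simp
qed (use ab g in simp_all)

text \<open>Row \<open>m + q\<close> takes the value \<open>b * g (Suc q)\<close> on
  \<open>u\<close>, by a clause of \<open>kernel_pair\<close>, and a * g (q + 1) - b^2 * g q = g (q
  + 2) on \<open>v\<close>. The condition on \<open>q\<close> keeps the new vertex
  \<open>m + q + 1\<close> away from the left end, even when the latter is n - 1.\<close>

lemma eliminate_right:
  assumes inv: "kernel_pair q u v" and q: "q < m \<or> q = m \<and> n = 2 * m + 3"
  shows "unitary_equivalent n (reduced q u v)
    (fun_mat n (eliminated n (cyclic n a b) (insert (m + q) (arc q))
      (left_end q) (\<lambda>k. u k - (if k = m + q + 1 then g (Suc q) else 0))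
      (m + q + 1) (\<lambda>k. (if k = m + q + 1 then g (Suc (Suc q)) else 0) - b * v k)))"
proof -
  have lt: "m + q + 1 < n - 1" and n3: "n \<ge> 3" using q n by auto
  have b: "cyclic n a b (m + q) (m + q + 1) = b" using lt by (auto simp: cyclic_def)
  have "u (m + q + 1) = 0" "v (m + q + 1) = 0"
    using inv lt q unfolding kernel_pair_def arc_def left_end_def by auto
  moreover have "(\<Sum>k<n. cyclic n a b (m + q) k * w k)
      = a * w (m + q) + b * w (m + q + 1) + b * w (m + q - 1)" for w
    using sum_cyclic[of "m + q" n a b w] lt n3 m by simp
  ultimately have "(\<Sum>k<n. cyclic n a b (m + q) k * u k) = b * g (Suc q)"
    "(\<Sum>k<n. cyclic n a b (m + q) k * v k) = g (Suc (Suc q))"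
    using inv unfolding kernel_pair_def
    by (auto simp: g(3) algebra_simps power2_eq_square)
  then have "unitary_equivalent n (reduced q u v)
    (fun_mat n (eliminated n (cyclic n a b) (insert (m + q) (arc q))
      (left_end q) (\<lambda>k. u k - (if k = m + q + 1 then g (Suc q) else 0))
      (m + q + 1) (\<lambda>k. (if k = m + q + 1 then g (Suc (Suc q)) else 0)
         - cyclic n a b (m + q) (m + q + 1) * v k)))"
    by (intro eliminate_row)
      (use lt q m comaximal_g b in \<open>auto simp: arc_def left_end_def cyclic_def\<close>)
  then show ?thesis unfolding b .
qed

text \<open>After the step to the right, the left end is eliminated by the mirrored step, with the
  roles of \<open>u\<close> and \<open>v\<close> exchanged. Only after both steps do the vectors
  regain the symmetric shape of \<open>kernel_pair\<close>.\<close>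

lemma eliminate_right_left:
  assumes inv: "kernel_pair q u v" and q: "q < m"
  shows "\<exists>u' v'. kernel_pair (Suc q) u' v' \<and>
    unitary_equivalent n (reduced q u v) (reduced (Suc q) u' v')"
proof -
  let ?y = "m + q + 1" and ?x = "left_end (Suc q)" and ?r = "left_end q"
  let ?A = "insert (m + q) (arc q)"
  \<comment> \<open>The index 1 marks the vectors after the step to the right, the index 2 those
    after the step to the left.\<close>
  define u1 where "u1 = (\<lambda>k. u k - (if k = ?y then g (Suc q) else 0))"
  define v1 where "v1 = (\<lambda>k. (if k = ?y then g (Suc (Suc q)) else 0) - b * v k)"
  define u2 where "u2 = (\<lambda>k. (if k = ?x then g (Suc (Suc q)) else 0) - b * u1 k)"
  define v2 where "v2 = (\<lambda>k. v1 k - (if k = ?x then - b * g (Suc q) else 0))"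
  have n3: "n \<ge> 3" and lt: "?y < n - 1" using m q n by auto
  have x: "?x < n" "?x \<notin> arc q" "?x \<noteq> ?y" "?x \<noteq> m + q" "?x \<noteq> ?r"
    using q n by (auto simp: left_end_def arc_def)
  have y: "?y \<notin> arc q" "?y \<noteq> ?r" using q by (auto simp: left_end_def arc_def)
  have r: "?r = m - 1 - q" "?r \<noteq> n - 1" "?r + 1 = m - q" using q n by (auto simp: left_end_def)
  \<comment> \<open>For q = m - 1 the left end is vertex 0, and its outer neighbour n - 1 is
    \<open>left_end m\<close>.\<close>
  have x_pred: "(if ?r = 0 then n - 1 else ?r - 1) = ?x" using q by (auto simp: left_end_def)
  have b: "cyclic n a b ?r ?x = b" using q n by (auto simp: cyclic_def left_end_def)
  have uv0: "u ?x = 0" "v ?x = 0" "u ?y = 0" "v ?y = 0"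
    using inv x y unfolding kernel_pair_def by auto
  have row: "(\<Sum>k<n. cyclic n a b ?r k * w k) = a * w ?r + b * w (m - q) + b * w ?x" for w
  proof -
    have "?r < n" using r(1) n by auto
    from sum_cyclic[OF this n3, of a b w] show ?thesis
      unfolding x_pred using r(2,3) by simp
  qed
  have "m - q \<noteq> ?y" "?y \<noteq> m - q" by auto
  then have vals: "u1 ?r = u ?r" "u1 (m - q) = u (m - q)" "u1 ?x = 0"
    "v1 ?r = - b * v ?r" "v1 (m - q) = - b * v (m - q)" "v1 ?x = 0"
    using x y uv0 unfolding u1_def v1_def by auto
  have b_v: "b * v (m - q) + a * v ?r = b * g (Suc q)"
    using inv unfolding kernel_pair_def by blast
  have "(\<Sum>k<n. cyclic n a b ?r k * v1 k) = - b * (b * v (m - q) + a * v ?r)"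
    unfolding row vals by (simp add: algebra_simps)
  also have "\<dots> = b * (- b * g (Suc q))"
    unfolding b_v by simp
  finally have sum_v1: "(\<Sum>k<n. cyclic n a b ?r k * v1 k) = b * (- b * g (Suc q))" .
  have sum_u1: "(\<Sum>k<n. cyclic n a b ?r k * u1 k) = g (Suc (Suc q))"
    using inv unfolding row vals kernel_pair_def
    by (simp add: g(3) power2_eq_square mult.assoc)
  have zero: "cyclic n a b ?r j = 0"
    if "j < n" "j \<notin> ?A" "j \<noteq> ?y" "j \<noteq> ?r" "j \<noteq> ?x" for j
  proof -
    have "m - q \<in> ?A" using q by (auto simp: arc_def)
    then have "j \<noteq> m - q" using that(2) by blast
    then show ?thesis
      using that(4,5) r(2,3) unfolding cyclic_def x_pred by simp
  qed
  have "unitary_equivalent n (reduced q u v)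
      (fun_mat n (eliminated n (cyclic n a b) ?A ?r u1 ?y v1))"
    unfolding u1_def v1_def by (rule eliminate_right) (use inv q in auto)
  \<comment> \<open>The two recorded columns are listed in the other order, since
    \<open>eliminate_row\<close> removes the second of them.\<close>
  then have right: "unitary_equivalent n (reduced q u v)
      (fun_mat n (eliminated n (cyclic n a b) ?A ?y v1 ?r u1))"
    by (simp only: eliminated_commute[OF y(2)[symmetric]])
  have "unitary_equivalent n (fun_mat n (eliminated n (cyclic n a b) ?A ?y v1 ?r u1))
      (fun_mat n (eliminated n (cyclic n a b) (insert ?r ?A)
        ?y (\<lambda>k. v1 k - (if k = ?x then - b * g (Suc q) else 0))
        ?x (\<lambda>k. (if k = ?x then g (Suc (Suc q)) else 0) - cyclic n a b ?r ?x * u1 k)))"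
  proof (rule eliminate_row)
    show "?y < n" "?r < n" using lt r(1) by linarith+
    show "?x < n" "?r \<noteq> ?x" "?y \<noteq> ?r" "?y \<noteq> ?x"
      by (rule x(1) x(5)[symmetric] y(2) x(3)[symmetric])+
    show "?y \<notin> ?A" "?x \<notin> ?A" using x y by simp_all
    show "?r \<notin> ?A" using q by (auto simp: left_end_def arc_def)
    show "(\<Sum>k<n. cyclic n a b ?r k * v1 k) = cyclic n a b ?r ?x * (- b * g (Suc q))"
      unfolding b by (rule sum_v1)
    show "comaximal (g (Suc (Suc q))) (cyclic n a b ?r ?x)"
      unfolding b by (rule comaximal_g)
  qed (fact zero sum_u1)+
  then have left: "unitary_equivalent n (fun_mat n (eliminated n (cyclic n a b) ?A ?y v1 ?r u1))
      (fun_mat n (eliminated n (cyclic n a b) (insert ?r ?A) ?x u2 ?y v2))"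
    by (simp only: b u2_def v2_def eliminated_commute[OF x(3)])
  have "insert ?r ?A = arc (Suc q)"
    using q by (auto simp: arc_def left_end_def)
  then have equiv: "unitary_equivalent n (reduced q u v) (reduced (Suc q) u2 v2)"
    using unitary_equivalent_trans[OF right left] by simp
  have supp: "u2 k = 0 \<and> v2 k = 0"
    if "k \<notin> arc (Suc q)" "k \<noteq> ?x" "k \<noteq> ?y" for k
  proof -
    have "k \<notin> arc q" "k \<noteq> ?r" "k \<noteq> m + q" using that q by (auto simp: arc_def left_end_def)
    then show ?thesis using inv that unfolding kernel_pair_def u2_def v2_def u1_def v1_def by simp
  qed
  \<comment> \<open>The positions named in \<open>kernel_pair (Suc q)\<close> are the new ends
    \<open>?x\<close>, \<open>?y\<close> and the old ends \<open>?r\<close>, \<open>m + q\<close>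
    next to them.\<close>
  have "?r \<noteq> ?x" "m + q \<noteq> ?x" "?y \<noteq> ?x" "?r \<noteq> ?y" "m + q \<noteq> ?y" "m - Suc q = ?r"
    using x y r by auto
  then have "kernel_pair (Suc q) u2 v2"
    using inv supp x uv0 unfolding kernel_pair_def u2_def v2_def u1_def v1_def
    by (simp add: g(3) algebra_simps power2_eq_square)
  then show ?thesis using equiv by blast
qed

lemma cyclic_reduced:
  assumes "q \<le> m"
  shows "\<exists>u v. kernel_pair q u v \<and>
    unitary_equivalent n (fun_mat n (cyclic n a b)) (reduced q u v)"
  using assms
proof (induction q)
  case 0
  \<comment> \<open>The arc starts empty between the adjacent vertices m - 1 and m, which are
    distinct because m >= 1.\<close>
  let ?u = "\<lambda>k. if k = m - 1 then 1 else 0 :: 'a" and ?v = "\<lambda>k. if k = m then 1 else 0 :: 'a"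
  have "kernel_pair 0 ?u ?v"
    using m g(1,2) by (auto simp: kernel_pair_def left_end_def)
  moreover have "unitary_equivalent n (fun_mat n (cyclic n a b)) (reduced 0 ?u ?v)"
  proof -
    have "m - 1 < n" "m < n" using n by auto
    from eliminated_empty[OF this, of "cyclic n a b"] show ?thesis
      using m unitary_equivalent_refl[of "fun_mat n (cyclic n a b)" n]
      by (simp add: arc_def left_end_def)
  qed
  ultimately show ?case by blast
next
  case (Suc q)
  then obtain u v where "kernel_pair q u v"
    and uv: "unitary_equivalent n (fun_mat n (cyclic n a b)) (reduced q u v)" by auto
  then obtain u' v' where "kernel_pair (Suc q) u' v'"
    "unitary_equivalent n (reduced q u v) (reduced (Suc q) u' v')"
    using eliminate_right_left[of q u v] Suc.prems by auto
  then show ?case using unitary_equivalent_trans[OF uv] by blast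
qed

text \<open>The arc now fills 0, ..., n - 3, and the rows of its two ends, n - 2 and n - 1, form the
  block. On the diagonal the terms with \<open>g m\<close> cancel; off the diagonal two equal terms
  \<open>b * g (Suc m)\<close> add up.\<close>

lemma cyclic_even:
  assumes n': "n = 2 * m + 2"
  shows "unitary_equivalent n (fun_mat n (cyclic n a b))
    (fun_mat n (corner (n - 2)
      (g (Suc m) * a) (g (Suc m) * (2 * b)) (g (Suc m) * (2 * b)) (g (Suc m) * a)))"
proof -
  let ?x = "2 * m" and ?y = "2 * m + 1"
  obtain u v where inv: "kernel_pair m u v"
    and red: "unitary_equivalent n (fun_mat n (cyclic n a b)) (reduced m u v)"
    using cyclic_reduced by blast
  have last: "left_end m = ?y" unfolding left_end_def using n' by simp
  have arc: "arc m = {..<?x}" by (auto simp: arc_def)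
  have n_2: "n - 2 = ?x" and x: "n = ?x + 2" using n' by simp_all
  have "(\<Sum>k<n. cyclic n a b ?x k * w k) = a * w ?x + b * w ?y + b * w (?x - 1)"
    "(\<Sum>k<n. cyclic n a b ?y k * w k) = a * w ?y + b * w 0 + b * w ?x" for w
    using sum_cyclic[of ?x n a b w] sum_cyclic[of ?y n a b w] n' m by simp_all
  then have sums: "(\<Sum>k<n. cyclic n a b ?y k * u k) = g (Suc m) * a"
    "(\<Sum>k<n. cyclic n a b ?y k * v k) = g (Suc m) * (2 * b)"
    "(\<Sum>k<n. cyclic n a b ?x k * u k) = g (Suc m) * (2 * b)"
    "(\<Sum>k<n. cyclic n a b ?x k * v k) = g (Suc m) * a"
    using inv unfolding kernel_pair_def last
    by (auto simp: algebra_simps simp flip: mult_2)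
  from red eliminated_corner[OF x, of "cyclic n a b" u v] show ?thesis
    unfolding n_2 last arc sums mult_2[symmetric] by (rule unitary_equivalent_trans)
qed

text \<open>One further step to the right leaves the block with rows d (a + b, - 1) and d (b, 1),
  where \<open>d\<close> is the common factor. A row operation and a column operation of determinant
  1 make it diagonal.\<close>

lemma cyclic_odd:
  assumes n': "n = 2 * m + 3"
  shows "unitary_equivalent n (fun_mat n (cyclic n a b))
    (fun_mat n (corner (n - 2) (g (Suc (Suc m)) - b * g (Suc m)) 0 0
       ((g (Suc (Suc m)) - b * g (Suc m)) * (a + 2 * b))))"
proof -
  let ?x = "2 * m + 1" and ?y = "2 * m + 2"
  define d where "d = g (Suc (Suc m)) - b * g (Suc m)"
  obtain u v where inv: "kernel_pair m u v"
    and red: "unitary_equivalent n (fun_mat n (cyclic n a b)) (reduced m u v)"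
    using cyclic_reduced by blast
  define u' where "u' = (\<lambda>k. u k - (if k = m + m + 1 then g (Suc m) else 0))"
  define v' where "v' = (\<lambda>k. (if k = m + m + 1 then g (Suc (Suc m)) else 0) - b * v k)"
  have last: "left_end m = ?y" unfolding left_end_def using n' by simp
  have arc: "insert (2 * m) (arc m) = {..<?x}" by (auto simp: arc_def)
  have n_2: "n - 2 = ?x" and x: "n = ?x + 2" and y: "?x + 1 = ?y" using n' by simp_all
  have rows: "(\<Sum>k<n. cyclic n a b ?x k * w k) = a * w ?x + b * w ?y + b * w (2 * m)"
    "(\<Sum>k<n. cyclic n a b ?y k * w k) = a * w ?y + b * w 0 + b * w ?x" for w
    using sum_cyclic[of ?x n a b w] sum_cyclic[of ?y n a b w] n' m by simp_all
  have uv0: "u ?x = 0" "v ?x = 0"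
    using inv unfolding kernel_pair_def arc_def last by auto
  \<comment> \<open>\<open>kernel_pair\<close> determines \<open>v 0\<close> only after
    multiplication by \<open>b\<close>; this is enough, as row \<open>?y\<close> contains
    \<open>v' 0\<close> with the factor \<open>b\<close>.\<close>
  have first: "b * v' 0 = - b * (b * g (Suc m) - a * (b * g m))"
  proof -
    have b_v: "b * v 0 = b * g (Suc m) - a * (b * g m)"
      using inv unfolding kernel_pair_def last by (auto simp: algebra_simps)
    have "b * v' 0 = - b * (b * v 0)" by (simp add: v'_def)
    then show ?thesis unfolding b_v .
  qed
  have vals: "u' ?x = - g (Suc m)" "u' ?y = g (Suc m)" "u' (2 * m) = b * g m" "u' 0 = - b * g m"
    "v' ?x = g (Suc (Suc m))" "v' ?y = - b * (b * g m)" "v' (2 * m) = - b * g (Suc m)"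
    using inv uv0 unfolding kernel_pair_def last u'_def v'_def
    by (auto simp: algebra_simps simp flip: mult_2)
  have sums: "(\<Sum>k<n. cyclic n a b ?x k * u' k) = - d"
    "(\<Sum>k<n. cyclic n a b ?y k * u' k) = d"
    "(\<Sum>k<n. cyclic n a b ?x k * v' k) = d * (a + b)"
    "(\<Sum>k<n. cyclic n a b ?y k * v' k) = d * b"
    unfolding rows vals first d_def by (simp_all add: g(3) algebra_simps power2_eq_square)
  note red
  also have "unitary_equivalent n (reduced m u v)
    (fun_mat n (eliminated n (cyclic n a b) {..<?x} ?y u' ?x v'))"
  proof -
    have "unitary_equivalent n (reduced m u v)
      (fun_mat n (eliminated n (cyclic n a b) (insert (m + m) (arc m)) (left_end m) u' (m + m + 1) v'))"
      unfolding u'_def v'_def by (rule eliminate_right[OF inv]) (use n' in simp)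
    then show ?thesis unfolding last mult_2[symmetric] arc .
  qed
  also have "unitary_equivalent n (fun_mat n (eliminated n (cyclic n a b) {..<?x} ?y u' ?x v'))
    (fun_mat n (corner ?x (d * (a + b)) (- d) (d * b) d))"
    using eliminated_corner[OF x, of "cyclic n a b" u' v'] unfolding y sums .
  \<comment> \<open>The second row moves up and minus the sum of both rows takes its place below,
    where \<open>- d\<close> and \<open>d\<close> cancel.\<close>
  also have "unitary_equivalent n (fun_mat n (corner ?x (d * (a + b)) (- d) (d * b) d))
    (fun_mat n (corner ?x (d * b) d (- (d * (a + 2 * b))) 0))"
    using corner_row_op[OF x, of 0 "- 1" 1 "- 1" "d * (a + b)" "- d" "d * b" d]
    by (simp add: algebra_simps mult_2)
  \<comment> \<open>The second column moves to the front, and \<open>b\<close> times it minus the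
    first column becomes the new second column.\<close>
  also have "unitary_equivalent n (fun_mat n (corner ?x (d * b) d (- (d * (a + 2 * b))) 0))
    (fun_mat n (corner ?x d 0 0 (d * (a + 2 * b))))"
    using corner_col_op[OF x, of 0 b 1 "- 1" "d * b" d "- (d * (a + 2 * b))" 0] by simp
  finally show ?thesis unfolding n_2 d_def .
qed

end

section \<open>Evaluation of the polynomials and the four families\<close>

theorem theorem2p1:
  fixes a b :: "'a :: comm_ring_1"
    and f :: "int \<Rightarrow> 'a poly poly"
  assumes unimodular: "\<exists>x y. a * x + b * y = 1"
    and f_neg: "f (-1) = 0"
    and f_zero: "f 0 = 1"
    and f_rec: "\<forall>n \<ge> 1. f n = var_x * f (n - 1) - var_y ^ 2 * f (n - 2)"
  shows
    "(\<forall>n::nat. n \<ge> 2 \<longrightarrow>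
       unitary_equivalent n (T_mat n a b)
         (mat_diag n (\<lambda>i. if i = n - 1 then eval2 (f (int n)) a b else 1))) \<and>
     (\<forall>n::nat. n \<ge> 2 \<longrightarrow>
       unitary_equivalent n (P_mat n a b)
         (mat_diag n (\<lambda>i. if i = n - 1 then (a + 2 * b) * eval2 (f (int n - 1)) a b else 1))) \<and>
     (\<forall>n::nat. n \<ge> 2 \<longrightarrow>
       unitary_equivalent n (K_mat n a b)
         (mat_diag n (\<lambda>i. if i = 0 then 1
                          else if i = n - 1 then a * (a + of_nat n * b)
                          else a))) \<and>
     (\<forall>n::nat. n \<ge> 4 \<longrightarrow>
       (\<forall>q::nat. n - 2 = 2 * q \<longrightarrow>
          unitary_equivalent n (C_mat n a b)
            (diag_block_mat [1\<^sub>m (n - 2),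
               eval2 (f (int q)) a b \<cdot>\<^sub>m mat_of_rows_list 2 [[a, 2 * b], [2 * b, a]]])) \<and>
       (\<forall>q::nat. n - 2 = 2 * q + 1 \<longrightarrow>
          unitary_equivalent n (C_mat n a b)
            (diag_block_mat [1\<^sub>m (n - 2),
               (eval2 (f (int q + 1)) a b - b * eval2 (f (int q)) a b) \<cdot>\<^sub>m
                 mat_of_rows_list 2 [[1, 0], [0, a + 2 * b]]])))"
proof -
  \<comment> \<open>The shift by one turns the initial index -1 into the natural number 0.\<close>
  define g where "g k = eval2 (f (int k - 1)) a b" for k :: nat
  have g0: "g 0 = 0" and g1: "g 1 = 1"
    using f_neg f_zero by (simp_all add: g_def eval2_simps)
  have g_rec: "g (Suc (Suc k)) = a * g (Suc k) - b ^ 2 * g k" for k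
  proof -
    have "f (int k + 1) = var_x * f (int k) - var_y ^ 2 * f (int k - 1)"
      using f_rec[rule_format, of "int k + 1"] by (simp add: algebra_simps)
    moreover have "int (Suc (Suc k)) - 1 = int k + 1" "int (Suc k) - 1 = int k" by simp_all
    ultimately show ?thesis by (simp only: g_def eval2_simps)
  qed
  have f_g: "eval2 (f (int k)) a b = g (Suc k)" for k
    by (simp add: g_def)
  have T: "unitary_equivalent n (T_mat n a b)
      (mat_diag n (\<lambda>i. if i = n - 1 then eval2 (f (int n)) a b else 1))" if n: "n \<ge> 2" for n
  proof -
    obtain m where m: "n = Suc (Suc m)" using le_Suc_ex[OF n] by auto
    have "unitary_equivalent n (fun_mat n (tridiagonal n a a a b))
      (mat_diag n (\<lambda>i. if i = n - 1 then a * g (Suc (n - 1)) - b ^ 2 * g (Suc (n - 2)) else 1))"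
      by (rule tridiagonal_equivalent) (use n unimodular g0 g1 g_rec in auto)
    moreover have "a * g (Suc (n - 1)) - b ^ 2 * g (Suc (n - 2)) = g (Suc n)"
      by (simp add: m g_rec)
    ultimately show ?thesis by (simp only: T_mat_eq f_g)
  qed
  have P: "unitary_equivalent n (P_mat n a b)
      (mat_diag n (\<lambda>i. if i = n - 1 then (a + 2 * b) * eval2 (f (int n - 1)) a b else 1))"
    if n: "n \<ge> 2" for n
  proof -
    obtain m where m: "n = Suc (Suc m)" using le_Suc_ex[OF n] by auto
    \<comment> \<open>This is f_k + b f_{k-1} at (a, b): as a combination of two solutions it
      satisfies the same recurrence, and it takes the value a + b at k = 1.\<close>
    let ?h = "\<lambda>k. g (Suc k) + b * g k"
    have "comaximal (a + b) b"
    proof -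
      obtain x y where "a * x + b * y = 1" using unimodular by blast
      then have "(a + b) * x + b * (y - x) = 1" by (simp add: algebra_simps)
      then show ?thesis by blast
    qed
    then have "unitary_equivalent n (fun_mat n (tridiagonal n (a + b) a (a + b) b))
      (mat_diag n (\<lambda>i. if i = n - 1 then (a + b) * ?h (n - 1) - b ^ 2 * ?h (n - 2) else 1))"
    proof (rule tridiagonal_equivalent[OF n unimodular])
      show "?h 0 = 1" "?h 1 = a + b"
        using g0 g1 g_rec[of 0] by simp_all
      show "?h (Suc (Suc k)) = a * ?h (Suc k) - b ^ 2 * ?h k" for k
        unfolding g_rec[of "Suc k"] g_rec[of k] by (simp add: algebra_simps)
    qed
    \<comment> \<open>The terms b^2 * g (n - 1) cancel, and b * (a * g (n - 1) - b^2 * g (n - 2)) is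
      a further b * g n.\<close>
    moreover have "(a + b) * ?h (n - 1) - b ^ 2 * ?h (n - 2) = (a + 2 * b) * g n"
    proof -
      have "n - 1 = Suc m" "n - 2 = m" using m by simp_all
      then show ?thesis
        by (simp add: m g_rec[of m] algebra_simps power2_eq_square)
    qed
    ultimately show ?thesis by (simp only: P_mat_eq[OF n] g_def[of n])
  qed
  have C_even: "unitary_equivalent n (C_mat n a b) (diag_block_mat [1\<^sub>m (n - 2),
      eval2 (f (int q)) a b \<cdot>\<^sub>m mat_of_rows_list 2 [[a, 2 * b], [2 * b, a]]])"
    if nq: "n \<ge> 4" "n - 2 = 2 * q" for n q
  proof -
    \<comment> \<open>The bound n >= 4 yields q >= 1, as the locale demands of its parameter
      \<open>m\<close>.\<close>
    interpret cycle_elimination n q a b g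
      by standard (use nq unimodular g0 g1 g_rec in auto)
    have n23: "n \<ge> 2" "n \<ge> 3" "n = 2 * q + 2" using nq by simp_all
    show ?thesis
      unfolding C_mat_eq[OF n23(2)] f_g diag_block_mat_corner[OF n23(1)]
      by (rule cyclic_even[OF n23(3)])
  qed
  have C_odd: "unitary_equivalent n (C_mat n a b) (diag_block_mat [1\<^sub>m (n - 2),
      (eval2 (f (int q + 1)) a b - b * eval2 (f (int q)) a b) \<cdot>\<^sub>m
        mat_of_rows_list 2 [[1, 0], [0, a + 2 * b]]])"
    if nq: "n \<ge> 4" "n - 2 = 2 * q + 1" for n q
  proof -
    interpret cycle_elimination n q a b g
      by standard (use nq unimodular g0 g1 g_rec in auto)
    have n23: "n \<ge> 2" "n \<ge> 3" "n = 2 * q + 3" using nq by simp_all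
    have f_Suc: "eval2 (f (int q + 1)) a b = g (Suc (Suc q))"
      using f_g[of "Suc q"] by (simp add: add.commute)
    show ?thesis
      unfolding C_mat_eq[OF n23(2)] f_g f_Suc diag_block_mat_corner[OF n23(1)] mult_zero_right
        mult_1_right
      by (rule cyclic_odd[OF n23(3)])
  qed
  show ?thesis
  proof (intro conjI allI impI, goal_cases)
    case (1 n)
    then show ?case by (rule T)
  next
    case (2 n)
    then show ?case by (rule P)
  next
    case (3 n)
    then show ?case by (rule K_mat_equivalent[OF _ unimodular])
  next
    case (4 n q)
    then show ?case by (rule C_even)
  next
    case (5 n q)
    then show ?case by (rule C_odd)
  qed
qed

end
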